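(* Let $X$ and $B$ be ordered groups with positive cones $P_X$ and $P_B$, let $\varphi\colon B\times X\to X$ be an action of the group $B$ on the group $X$ by group automorphisms $\varphi_b=\varphi(b,-)$, and let $X\rtimes_\varphi B$ be the corresponding semidirect product of groups. The following conditions are equivalent: (i) there is a compatible positive cone on $X\rtimes_\varphi B$; (ii) for every $b\in B$ the map $\varphi_b\colon X\to X$ is monotone, and, if $b\sim 0$ in $B$, then $\varphi_b\sim \mathrm{id}$ pointwise, i.e. $\varphi_b(x)\sim x$ for all $x\in X$; (iii) the lexicographic order is compatible, i.e. the set $P_{\mathrm{lex}}=\{(x,b)\in X\times B \mid b>0\text{ or }(b\sim 0\text{ and }x\geq 0)\}$ is a positive cone on $X\rtimes_\varphi B$ and it is compatible.
   Context: "Order" means preorder (reflexive and transitive, not necessarily antisymmetric). An ordered group is a (not necessarily abelian) group, written additively, with an order $\leq$ for which addition is monotone ($x\le x'$ and $y\le y'$ imply $x+y\le x'+y'$). Write $x\sim y$ for $x\leq y$ and $y\leq x$, and $x>0$ for $x\geq 0$ and not $x\sim 0$. The positive cone of an ordered group $X$ is $P_X=\{x\in X: x\geq 0\}$; a positive cone on a group is a submonoid closed under conjugation, and positive cones correspond bijectively to group orders (with $x\le y$ iff $y-x\in P$). $\mathsf{OrdGrp}$ is the category of ordered groups and monotone group homomorphisms. The semidirect product $X\rtimes_\varphi B$ has underlying set $X\times B$ and operation $(x,b)+(x',b')=(x+\varphi_b(x'),b+b')$. A positive cone $P$ on $X\rtimes_\varphi B$ is called compatible if, with the order given by $P$, the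 sequence $X\xrightarrow{\langle 1,0\rangle}X\rtimes_\varphi B\xrightarrow{\pi_B}B$ together with the section $\langle 0,1\rangle\colon B\to X\rtimes_\varphi B$ is a split extension in $\mathsf{OrdGrp}$, where $\langle 1,0\rangle(x)=(x,0)$, $\pi_B(x,b)=b$, $\langle 0,1\rangle(b)=(0,b)$; that is, all three maps are monotone, $\langle 1,0\rangle$ is a kernel of $\pi_B$ and $\pi_B$ is a cokernel of $\langle 1,0\rangle$ in $\mathsf{OrdGrp}$. (A kernel in $\mathsf{OrdGrp}$ is a group-theoretic kernel carrying the order induced from the domain.) *)

theory Defs
  imports "HOL-Algebra.Group_Action"
begin

text \<open>Groups are not assumed abelian. They are written multiplicatively, following HOL-Algebra:
  \<open>\<otimes>\<close>, \<open>\<one>\<close> and \<open>inv\<close> stand for the additive \<open>+\<close>, \<open>0\<close> and \<open>-\<close> customary for ordered groups.\<close>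

section \<open>Preordered groups\<close>

record 'a ordgrp = "'a monoid" +
  leq :: "'a \<Rightarrow> 'a \<Rightarrow> bool" (infixl \<open>\<preceq>\<index>\<close> 50)

locale ordered_group = group G for G (structure) +
  assumes leq_refl: "x \<in> carrier G \<Longrightarrow> x \<preceq> x"
    and leq_trans: "\<lbrakk>x \<in> carrier G; y \<in> carrier G; z \<in> carrier G; x \<preceq> y; y \<preceq> z\<rbrakk> \<Longrightarrow> x \<preceq> z"
    and mult_mono: "\<lbrakk>x \<in> carrier G; x' \<in> carrier G; y \<in> carrier G; y' \<in> carrier G; x \<preceq> x'; y \<preceq> y'\<rbrakk>
      \<Longrightarrow> x \<otimes> y \<preceq> x' \<otimes> y'"

definition ord_equiv :: "'a ordgrp \<Rightarrow> 'a \<Rightarrow> 'a \<Rightarrow> bool" where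
  "ord_equiv G x y \<longleftrightarrow> x \<preceq>\<^bsub>G\<^esub> y \<and> y \<preceq>\<^bsub>G\<^esub> x"

definition strictly_positive :: "'a ordgrp \<Rightarrow> 'a \<Rightarrow> bool" where
  "strictly_positive G x \<longleftrightarrow> \<one>\<^bsub>G\<^esub> \<preceq>\<^bsub>G\<^esub> x \<and> \<not> ord_equiv G x \<one>\<^bsub>G\<^esub>"

definition positive_cone :: "'a monoid \<Rightarrow> 'a set \<Rightarrow> bool" where
  "positive_cone G P \<longleftrightarrow>
    submonoid P G \<and> (\<forall>g\<in>carrier G. \<forall>p\<in>P. g \<otimes>\<^bsub>G\<^esub> p \<otimes>\<^bsub>G\<^esub> inv\<^bsub>G\<^esub> g \<in> P)"

definition with_cone :: "'a monoid \<Rightarrow> 'a set \<Rightarrow> 'a ordgrp" where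
  "with_cone G P = \<lparr>carrier = carrier G, mult = mult G, one = one G,
     leq = (\<lambda>x y. y \<otimes>\<^bsub>G\<^esub> inv\<^bsub>G\<^esub> x \<in> P)\<rparr>"

definition ord_hom :: "'a ordgrp \<Rightarrow> 'b ordgrp \<Rightarrow> ('a \<Rightarrow> 'b) set" where
  "ord_hom G H = {f \<in> hom G H. monotone_on (carrier G) (leq G) (leq H) f}"

definition ord_kernel :: "'k ordgrp \<Rightarrow> 'g ordgrp \<Rightarrow> 'q ordgrp \<Rightarrow> ('k \<Rightarrow> 'g) \<Rightarrow> ('g \<Rightarrow> 'q) \<Rightarrow> bool" where
  "ord_kernel K G Q k q \<longleftrightarrow>
    k \<in> ord_hom K G \<and> inj_on k (carrier K) \<and> k ` carrier K = kernel G Q q \<and>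
    (\<forall>x\<in>carrier K. \<forall>y\<in>carrier K. x \<preceq>\<^bsub>K\<^esub> y \<longleftrightarrow> k x \<preceq>\<^bsub>G\<^esub> k y)"

text \<open>The universal property of the cokernel. A definition cannot quantify over types, so the test
  objects \<open>Z\<close> are the ordered groups carried by subsets of the type \<open>'g + 'q\<close>. This loses nothing:
  by \<open>ord_cokernel_universal\<close> below, the universal property then holds for ordered groups over
  every type. Extensionality makes functions that agree on the carrier equal.\<close>

definition ord_cokernel :: "'k ordgrp \<Rightarrow> 'g ordgrp \<Rightarrow> 'q ordgrp \<Rightarrow> ('k \<Rightarrow> 'g) \<Rightarrow> ('g \<Rightarrow> 'q) \<Rightarrow> bool" where
  "ord_cokernel K G Q k q \<longleftrightarrow>
    q \<in> ord_hom G Q \<and> (\<forall>x\<in>carrier K. q (k x) = \<one>\<^bsub>Q\<^esub>) \<and>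
    (\<forall>(Z :: ('g + 'q) ordgrp) h. ordered_group Z \<longrightarrow> h \<in> ord_hom G Z \<longrightarrow>
       (\<forall>x\<in>carrier K. h (k x) = \<one>\<^bsub>Z\<^esub>) \<longrightarrow>
       (\<exists>!u. u \<in> ord_hom Q Z \<inter> extensional (carrier Q) \<and> (\<forall>g\<in>carrier G. u (q g) = h g)))"

definition ord_split_extension ::
  "'k ordgrp \<Rightarrow> 'g ordgrp \<Rightarrow> 'q ordgrp \<Rightarrow> ('k \<Rightarrow> 'g) \<Rightarrow> ('g \<Rightarrow> 'q) \<Rightarrow> ('q \<Rightarrow> 'g) \<Rightarrow> bool" where
  "ord_split_extension K G Q k q s \<longleftrightarrow>
    ordered_group K \<and> ordered_group G \<and> ordered_group Q \<and>
    k \<in> ord_hom K G \<and> q \<in> ord_hom G Q \<and> s \<in> ord_hom Q G \<and>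
    (\<forall>b\<in>carrier Q. q (s b) = b) \<and>
    ord_kernel K G Q k q \<and> ord_cokernel K G Q k q"


section \<open>Semidirect products\<close>

text \<open>Library group actions take values in \<open>BijGroup\<close>, so each \<open>\<phi> b\<close> is
  \<open>undefined\<close> outside the carrier of \<open>X\<close>.\<close>

definition acts_by_automorphisms :: "'b ordgrp \<Rightarrow> 'x ordgrp \<Rightarrow> ('b \<Rightarrow> 'x \<Rightarrow> 'x) \<Rightarrow> bool" where
  "acts_by_automorphisms B X \<phi> \<longleftrightarrow>
    group_action B (carrier X) \<phi> \<and> (\<forall>b\<in>carrier B. \<phi> b \<in> auto X)"

definition semidirect :: "'x ordgrp \<Rightarrow> 'b ordgrp \<Rightarrow> ('b \<Rightarrow> 'x \<Rightarrow> 'x) \<Rightarrow> ('x \<times> 'b) monoid" where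
  "semidirect X B \<phi> = \<lparr>carrier = carrier X \<times> carrier B,
     mult = (\<lambda>(x, b) (x', b'). (x \<otimes>\<^bsub>X\<^esub> \<phi> b x', b \<otimes>\<^bsub>B\<^esub> b')),
     one = (\<one>\<^bsub>X\<^esub>, \<one>\<^bsub>B\<^esub>)\<rparr>"

definition compatible_cone ::
  "'x ordgrp \<Rightarrow> 'b ordgrp \<Rightarrow> ('b \<Rightarrow> 'x \<Rightarrow> 'x) \<Rightarrow> ('x \<times> 'b) set \<Rightarrow> bool" where
  "compatible_cone X B \<phi> P \<longleftrightarrow>
    positive_cone (semidirect X B \<phi>) P \<and>
    ord_split_extension X (with_cone (semidirect X B \<phi>) P) B
      (\<lambda>x. (x, \<one>\<^bsub>B\<^esub>)) (\<lambda>(x, b). b) (\<lambda>b. (\<one>\<^bsub>X\<^esub>, b))"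

definition lex_cone :: "'x ordgrp \<Rightarrow> 'b ordgrp \<Rightarrow> ('x \<times> 'b) set" where
  "lex_cone X B = {(x, b) \<in> carrier X \<times> carrier B.
     strictly_positive B b \<or> (ord_equiv B b \<one>\<^bsub>B\<^esub> \<and> \<one>\<^bsub>X\<^esub> \<preceq>\<^bsub>X\<^esub> x)}"


section \<open>The cokernel is universal among ordered groups over all types\<close>

definition transport :: "('a \<Rightarrow> 'b) \<Rightarrow> 'a set \<Rightarrow> 'a ordgrp \<Rightarrow> 'b ordgrp" where
  "transport e S Z = (let d = the_inv_into S e in
    \<lparr>carrier = e ` S, mult = (\<lambda>x y. e (d x \<otimes>\<^bsub>Z\<^esub> d y)), one = e \<one>\<^bsub>Z\<^esub>,
     leq = (\<lambda>x y. d x \<preceq>\<^bsub>Z\<^esub> d y)\<rparr>)"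

lemma ordered_group_transport:
  assumes Z: "ordered_group Z" and S: "subgroup S Z" and e: "inj_on e S"
  shows "ordered_group (transport e S Z)"
    and "\<And>h G. h \<in> ord_hom G Z \<Longrightarrow> h ` carrier G \<subseteq> S \<Longrightarrow> e \<circ> h \<in> ord_hom G (transport e S Z)"
    and "the_inv_into S e \<in> ord_hom (transport e S Z) Z"
proof -
  interpret Z: ordered_group Z by fact
  interpret S: subgroup S Z by fact
  let ?d = "the_inv_into S e"
  have d: "?d (e x) = x" if "x \<in> S" for x
    using that e by (simp add: the_inv_into_f_f)
  have grp: "group (transport e S Z)"
  proof (rule groupI)
    fix x assume "x \<in> carrier (transport e S Z)"
    then obtain a where a: "a \<in> S" "x = e a" by (auto simp: transport_def Let_def)
    have "e (inv\<^bsub>Z\<^esub> a) \<in> carrier (transport e S Z)"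
      using a by (auto simp: transport_def Let_def)
    moreover have "e (inv\<^bsub>Z\<^esub> a) \<otimes>\<^bsub>transport e S Z\<^esub> x = \<one>\<^bsub>transport e S Z\<^esub>"
      using a d by (simp add: transport_def Let_def)
    ultimately show "\<exists>y\<in>carrier (transport e S Z). y \<otimes>\<^bsub>transport e S Z\<^esub> x = \<one>\<^bsub>transport e S Z\<^esub>"
      by blast
  qed (auto simp: transport_def Let_def d Z.m_assoc)
  then interpret T: group "transport e S Z" .
  show "ordered_group (transport e S Z)"
  proof unfold_locales
    fix x assume "x \<in> carrier (transport e S Z)"
    then show "x \<preceq>\<^bsub>transport e S Z\<^esub> x"
      by (auto simp: transport_def Let_def d intro: Z.leq_refl)
  next
    fix x y z
    assume "x \<in> carrier (transport e S Z)" "y \<in> carrier (transport e S Z)"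
      "z \<in> carrier (transport e S Z)"
      and "x \<preceq>\<^bsub>transport e S Z\<^esub> y" "y \<preceq>\<^bsub>transport e S Z\<^esub> z"
    then show "x \<preceq>\<^bsub>transport e S Z\<^esub> z"
      by (auto simp: transport_def Let_def d intro: Z.leq_trans[OF S.mem_carrier S.mem_carrier S.mem_carrier])
  next
    fix x x' y y'
    assume "x \<in> carrier (transport e S Z)" "x' \<in> carrier (transport e S Z)"
      "y \<in> carrier (transport e S Z)" "y' \<in> carrier (transport e S Z)"
      and "x \<preceq>\<^bsub>transport e S Z\<^esub> x'" "y \<preceq>\<^bsub>transport e S Z\<^esub> y'"
    then show "x \<otimes>\<^bsub>transport e S Z\<^esub> y \<preceq>\<^bsub>transport e S Z\<^esub> x' \<otimes>\<^bsub>transport e S Z\<^esub> y'"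
      by (auto simp: transport_def Let_def d intro!: Z.mult_mono)
  qed
  show "e \<circ> h \<in> ord_hom G (transport e S Z)"
    if "h \<in> ord_hom G Z" "h ` carrier G \<subseteq> S" for h and G :: "'c ordgrp"
  proof -
    have "h x \<in> S" if "x \<in> carrier G" for x
      using that \<open>h ` carrier G \<subseteq> S\<close> by blast
    then show ?thesis
      using that by (auto simp: ord_hom_def hom_def monotone_on_def transport_def Let_def d)
  qed
  show "?d \<in> ord_hom (transport e S Z) Z"
    by (auto simp: ord_hom_def hom_def monotone_on_def transport_def Let_def d)
qed

lemma ord_hom_compose:
  assumes "group G" "f \<in> ord_hom G H" "g \<in> ord_hom H K"
  shows "restrict (g \<circ> f) (carrier G) \<in> ord_hom G K \<inter> extensional (carrier G)"
proof -
  interpret group G by fact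
  show ?thesis
    using assms(2,3) by (auto simp: ord_hom_def hom_def monotone_on_def Pi_def)
qed

lemma ord_cokernel_surj:
  fixes G :: "'g ordgrp" and Q :: "'q ordgrp"
  assumes G: "ordered_group G" and Q: "ordered_group Q" and k: "k \<in> ord_hom K G"
    and coker: "ord_cokernel K G Q k q"
  shows "q ` carrier G = carrier Q"
proof -
  interpret G: ordered_group G by fact
  interpret Q: ordered_group Q by fact
  have q: "q \<in> ord_hom G Q" and qk: "\<forall>x\<in>carrier K. q (k x) = \<one>\<^bsub>Q\<^esub>"
    using coker by (auto simp: ord_cokernel_def)
  have qc: "q g \<in> carrier Q" if "g \<in> carrier G" for g
    using q that by (auto simp: ord_hom_def hom_def)
  have kc: "k x \<in> carrier G" if "x \<in> carrier K" for x
    using k that by (auto simp: ord_hom_def hom_def)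
  let ?S = "q ` carrier G"
  have S: "subgroup ?S Q"
    using q by (intro group_hom.img_is_subgroup)
      (auto simp: group_hom_def group_hom_axioms_def ord_hom_def)
  let ?e = "Inr :: 'q \<Rightarrow> 'g + 'q"
  have e: "inj_on ?e A" for A by simp
  let ?T = "transport ?e ?S Q" and ?T' = "transport ?e (carrier Q) Q"
  note t = ordered_group_transport[OF Q S e]
  note t' = ordered_group_transport[OF Q Q.subgroup_self e]
  have "?e \<circ> q \<in> ord_hom G ?T" using t(2)[OF q] by blast
  moreover have "\<forall>x\<in>carrier K. (?e \<circ> q) (k x) = \<one>\<^bsub>?T\<^esub>"
    using qk by (simp add: transport_def Let_def)
  ultimately obtain u where u: "u \<in> ord_hom Q ?T" "\<And>g. g \<in> carrier G \<Longrightarrow> u (q g) = ?e (q g)"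
    using coker t(1) unfolding ord_cokernel_def comp_apply by blast
  have ex1: "\<exists>!v. v \<in> ord_hom Q ?T' \<inter> extensional (carrier Q) \<and> (\<forall>g\<in>carrier G. v (q g) = (?e \<circ> q) g)"
  proof -
    have "?e \<circ> q \<in> ord_hom G ?T'" using t'(2)[OF q] qc by blast
    moreover have "\<forall>x\<in>carrier K. (?e \<circ> q) (k x) = \<one>\<^bsub>?T'\<^esub>"
      using qk by (simp add: transport_def Let_def)
    ultimately show ?thesis using coker t'(1) unfolding ord_cokernel_def by blast
  qed
  have uS: "u b \<in> ?e ` ?S" if "b \<in> carrier Q" for b
    using u(1) that by (auto simp: ord_hom_def hom_def transport_def Let_def)
  have hom_u: "restrict u (carrier Q) \<in> ord_hom Q ?T' \<inter> extensional (carrier Q)"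
  proof -
    let ?w = "restrict (the_inv_into ?S ?e \<circ> u) (carrier Q)"
    have w: "?w \<in> ord_hom Q Q" using ord_hom_compose[OF Q.is_group u(1) t(3)] by blast
    then have "?w ` carrier Q \<subseteq> carrier Q" unfolding ord_hom_def hom_def by blast
    with w have "?e \<circ> ?w \<in> ord_hom Q ?T'" by (rule t'(2))
    moreover have "(?e \<circ> ?w) b = u b" if "b \<in> carrier Q" for b
      using that uS f_the_inv_into_f[OF e] by simp
    ultimately show ?thesis
      by (auto simp: ord_hom_def hom_def monotone_on_def Pi_def)
  qed
  have hom_e: "restrict ?e (carrier Q) \<in> ord_hom Q ?T' \<inter> extensional (carrier Q)"
    by (auto simp: ord_hom_def hom_def monotone_on_def transport_def Let_def the_inv_into_f_f[OF e])
  have "restrict u (carrier Q) = restrict ?e (carrier Q)"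
  proof -
    have "restrict u (carrier Q) \<in> ord_hom Q ?T' \<inter> extensional (carrier Q) \<and>
        (\<forall>g\<in>carrier G. restrict u (carrier Q) (q g) = (?e \<circ> q) g)"
      using hom_u by (intro conjI ballI) (simp_all add: u(2) qc)
    moreover have "restrict ?e (carrier Q) \<in> ord_hom Q ?T' \<inter> extensional (carrier Q) \<and>
        (\<forall>g\<in>carrier G. restrict ?e (carrier Q) (q g) = (?e \<circ> q) g)"
      using hom_e by (intro conjI ballI) (simp_all add: qc)
    moreover have eq: "a = b" if "\<exists>!v. R v" "R a" "R b" for R and a b :: "'q \<Rightarrow> 'g + 'q"
      using that by blast
    ultimately show ?thesis by (intro eq[OF ex1])
  qed
  then have "u b = ?e b" if "b \<in> carrier Q" for b
    using that by (metis restrict_apply')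
  with uS have "carrier Q \<subseteq> ?S" by fastforce
  with qc show ?thesis by blast
qed

lemma ord_cokernel_universal:
  fixes G :: "'g ordgrp" and Q :: "'q ordgrp" and Z :: "'z ordgrp"
  assumes G: "ordered_group G" and Q: "ordered_group Q" and k: "k \<in> ord_hom K G"
    and coker: "ord_cokernel K G Q k q"
    and Z: "ordered_group Z" and h: "h \<in> ord_hom G Z" and hk: "\<forall>x\<in>carrier K. h (k x) = \<one>\<^bsub>Z\<^esub>"
  shows "\<exists>!u. u \<in> ord_hom Q Z \<inter> extensional (carrier Q) \<and> (\<forall>g\<in>carrier G. u (q g) = h g)"
proof -
  interpret G: ordered_group G by fact
  interpret Q: ordered_group Q by fact
  interpret Z: ordered_group Z by fact
  have qc: "q g \<in> carrier Q" if "g \<in> carrier G" for g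
    using coker that by (auto simp: ord_cokernel_def ord_hom_def hom_def)
  let ?S = "h ` carrier G"
  have S: "subgroup ?S Z"
    using h by (intro group_hom.img_is_subgroup)
      (auto simp: group_hom_def group_hom_axioms_def ord_hom_def)
  let ?e = "\<lambda>z. Inl (inv_into (carrier G) h z) :: 'g + 'q"
  have e: "inj_on ?e ?S"
    by (auto simp: inj_on_def inv_into_injective)
  let ?T = "transport ?e ?S Z" and ?d = "the_inv_into ?S ?e"
  note t = ordered_group_transport[OF Z S e]
  have "?e \<circ> h \<in> ord_hom G ?T" using t(2)[OF h] by blast
  moreover have "\<forall>x\<in>carrier K. (?e \<circ> h) (k x) = \<one>\<^bsub>?T\<^esub>"
    using hk by (simp add: transport_def Let_def)
  ultimately obtain u where u: "u \<in> ord_hom Q ?T" "\<forall>g\<in>carrier G. u (q g) = (?e \<circ> h) g"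
    using coker t(1) unfolding ord_cokernel_def by blast
  let ?v = "restrict (?d \<circ> u) (carrier Q)"
  show ?thesis
  proof (rule ex1I[of _ ?v])
    show "?v \<in> ord_hom Q Z \<inter> extensional (carrier Q) \<and> (\<forall>g\<in>carrier G. ?v (q g) = h g)"
      using ord_hom_compose[OF Q.is_group u(1) t(3)] u(2) qc the_inv_into_f_f[OF e]
      by auto
    fix w assume w: "w \<in> ord_hom Q Z \<inter> extensional (carrier Q) \<and> (\<forall>g\<in>carrier G. w (q g) = h g)"
    show "w = ?v"
    proof (rule extensionalityI)
      fix b assume "b \<in> carrier Q"
      then obtain g where "g \<in> carrier G" "b = q g"
        using ord_cokernel_surj[OF G Q k coker] by blast
      then show "w b = ?v b"
        using w u(2) qc the_inv_into_f_f[OF e] by auto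
    qed (use w in auto)
  qed
qed

end

theory Submission
  imports Defs
begin

text \<open>In a compatible order, conjugating \<open>(x, \<one>)\<close> by \<open>(\<one>, b)\<close> gives \<open>(\<phi> b x, \<one>)\<close>, so
  \<open>\<phi> b\<close> preserves positivity. If \<open>b \<sim> \<one>\<close>, then \<open>(\<one>, b)\<close> and \<open>(\<one>, inv b)\<close> are both positive;
  conjugating the first by \<open>(x, \<one>)\<close> and multiplying by the second shows that
  \<open>x \<otimes> inv (\<phi> b x)\<close> is positive, and replacing \<open>x\<close> by \<open>inv x\<close> gives the other inequality.
  Conversely, these two properties of \<open>\<phi>\<close> are what closure of the lexicographic cone
  under products and conjugation requires. The cokernel property is automatic as soon as
  the projection has a monotone section.\<close>

section \<open>Preordered groups\<close>

text \<open>Cancellation inside words already reassociated to the right by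
  \<open>m_assoc\<close>.\<close>

lemma (in group) mult_inv_cancel [simp]:
  assumes "x \<in> carrier G" "y \<in> carrier G"
  shows "inv x \<otimes> (x \<otimes> y) = y" "x \<otimes> (inv x \<otimes> y) = y"
  using assms by (simp_all flip: m_assoc)

section \<open>Inequalities expressed through positivity\<close>

context ordered_group
begin

text \<open>Right translation by \<open>inv x\<close>, and back by \<open>x\<close>. This lets a
  given order be compared with a cone, since \<open>with_cone\<close> also reads its order off the
  right quotient \<open>y \<otimes> inv x\<close>.\<close>

lemma leq_iff_one_leq_div:
  assumes "x \<in> carrier G" "y \<in> carrier G"
  shows "x \<preceq> y \<longleftrightarrow> \<one> \<preceq> y \<otimes> inv x"
proof
  assume "x \<preceq> y"
  then have "x \<otimes> inv x \<preceq> y \<otimes> inv x"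
    using assms by (intro mult_mono leq_refl) auto
  then show "\<one> \<preceq> y \<otimes> inv x" using assms by simp
next
  assume "\<one> \<preceq> y \<otimes> inv x"
  then have "\<one> \<otimes> x \<preceq> y \<otimes> inv x \<otimes> x"
    using assms by (intro mult_mono leq_refl) auto
  then show "x \<preceq> y" using assms by (simp add: m_assoc)
qed

lemma one_leq_mult:
  assumes "x \<in> carrier G" "y \<in> carrier G" "\<one> \<preceq> x" "\<one> \<preceq> y"
  shows "\<one> \<preceq> x \<otimes> y"
  using mult_mono[of \<one> x \<one> y] assms by simp

lemma conj_mono:
  assumes "g \<in> carrier G" "x \<in> carrier G" "y \<in> carrier G" "x \<preceq> y"
  shows "g \<otimes> x \<otimes> inv g \<preceq> g \<otimes> y \<otimes> inv g"
  using assms by (intro mult_mono leq_refl) auto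

lemma one_leq_conj:
  assumes "g \<in> carrier G" "x \<in> carrier G" "\<one> \<preceq> x"
  shows "\<one> \<preceq> g \<otimes> x \<otimes> inv g"
  using conj_mono[of g \<one> x] assms by simp

lemma conj_leq_one_iff:
  assumes "g \<in> carrier G" "x \<in> carrier G"
  shows "g \<otimes> x \<otimes> inv g \<preceq> \<one> \<longleftrightarrow> x \<preceq> \<one>"
proof
  assume "g \<otimes> x \<otimes> inv g \<preceq> \<one>"
  then show "x \<preceq> \<one>"
    using conj_mono[of "inv g" "g \<otimes> x \<otimes> inv g" \<one>] assms by (simp add: m_assoc)
next
  assume "x \<preceq> \<one>"
  then show "g \<otimes> x \<otimes> inv g \<preceq> \<one>"
    using conj_mono[of g x \<one>] assms by simp
qed

text \<open>Each factor lies below the product because the other factor is positive. For the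
  lexicographic cone this means that two positive elements of \<open>B\<close> whose product is
  equivalent to one are both equivalent to one.\<close>

lemma mult_leq_one_imp:
  assumes "x \<in> carrier G" "y \<in> carrier G" "\<one> \<preceq> x" "\<one> \<preceq> y" "x \<otimes> y \<preceq> \<one>"
  shows "x \<preceq> \<one>" "y \<preceq> \<one>"
proof -
  have "x \<preceq> x \<otimes> y" "y \<preceq> x \<otimes> y"
    using mult_mono[of x x \<one> y] mult_mono[of \<one> x y y] assms leq_refl by simp_all
  then show "x \<preceq> \<one>" "y \<preceq> \<one>"
    using assms by (auto intro: leq_trans[of _ "x \<otimes> y"])
qed

lemma leq_one_iff_one_leq_inv:
  assumes "x \<in> carrier G"
  shows "x \<preceq> \<one> \<longleftrightarrow> \<one> \<preceq> inv x"
  using assms by (simp add: leq_iff_one_leq_div[of x \<one>])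

end

section \<open>Orders defined by positive cones\<close>

lemma with_cone_simps [simp]:
  "carrier (with_cone G P) = carrier G"
  "x \<otimes>\<^bsub>with_cone G P\<^esub> y = x \<otimes>\<^bsub>G\<^esub> y"
  "\<one>\<^bsub>with_cone G P\<^esub> = \<one>\<^bsub>G\<^esub>"
  "x \<preceq>\<^bsub>with_cone G P\<^esub> y \<longleftrightarrow> y \<otimes>\<^bsub>G\<^esub> inv\<^bsub>G\<^esub> x \<in> P"
  by (simp_all add: with_cone_def)

lemma ordered_group_with_cone:
  fixes G (structure)
  assumes "group G" "positive_cone G P"
  shows "ordered_group (with_cone G P)"
proof -
  interpret group G by fact
  interpret P: submonoid P G using assms by (simp add: positive_cone_def)
  have conj: "g \<otimes> p \<otimes> inv g \<in> P" if "g \<in> carrier G" "p \<in> P" for g p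
    using that assms by (simp add: positive_cone_def)
  interpret W: group "with_cone G P"
    by (rule groupI) (auto simp: m_assoc intro: l_inv_ex)
  show ?thesis
  proof unfold_locales
    fix x y z
    assume "x \<in> carrier (with_cone G P)" "y \<in> carrier (with_cone G P)"
      "z \<in> carrier (with_cone G P)" "x \<preceq>\<^bsub>with_cone G P\<^esub> y" "y \<preceq>\<^bsub>with_cone G P\<^esub> z"
    moreover from this have "(z \<otimes> inv y) \<otimes> (y \<otimes> inv x) = z \<otimes> inv x"
      by (simp add: m_assoc)
    ultimately show "x \<preceq>\<^bsub>with_cone G P\<^esub> z"
      using P.m_closed[of "z \<otimes> inv y" "y \<otimes> inv x"] by simp
  next
    fix x x' y y'
    assume c: "x \<in> carrier (with_cone G P)" "x' \<in> carrier (with_cone G P)"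
      "y \<in> carrier (with_cone G P)" "y' \<in> carrier (with_cone G P)"
      and le: "x \<preceq>\<^bsub>with_cone G P\<^esub> x'" "y \<preceq>\<^bsub>with_cone G P\<^esub> y'"
    \<comment> \<open>Without commutativity, the quotient \<open>y' \<otimes> inv y\<close> sits
      between \<open>x'\<close> and \<open>inv x\<close>. Conjugating it by \<open>x'\<close>
      separates the two quotients known to lie in \<open>P\<close>.\<close>
    have "(x' \<otimes> (y' \<otimes> inv y) \<otimes> inv x') \<otimes> (x' \<otimes> inv x) = x' \<otimes> y' \<otimes> inv (x \<otimes> y)"
      using c by (simp add: m_assoc inv_mult_group)
    moreover have "(x' \<otimes> (y' \<otimes> inv y) \<otimes> inv x') \<otimes> (x' \<otimes> inv x) \<in> P"
      by (rule P.m_closed[OF conj]) (use c le in auto)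
    ultimately show "x \<otimes>\<^bsub>with_cone G P\<^esub> y \<preceq>\<^bsub>with_cone G P\<^esub> x' \<otimes>\<^bsub>with_cone G P\<^esub> y'"
      by simp
  qed simp
qed

text \<open>A morphism \<open>h\<close> that kills the image of \<open>k\<close> factors through
  \<open>q\<close> by way of \<open>h \<circ> s\<close>, which is monotone as a composite.
  Uniqueness follows because \<open>s\<close> makes \<open>q\<close> surjective.\<close>

lemma ord_cokernel_of_section:
  fixes G :: "'g ordgrp" and Q :: "'q ordgrp"
  assumes G: "ordered_group G" and Q: "ordered_group Q"
    and q: "q \<in> ord_hom G Q" and s: "s \<in> ord_hom Q G"
    and qs: "\<And>b. b \<in> carrier Q \<Longrightarrow> q (s b) = b"
    and k: "k ` carrier K = kernel G Q q"
  shows "ord_cokernel K G Q k q"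
proof -
  interpret G: ordered_group G by fact
  interpret Q: ordered_group Q by fact
  interpret q: group_hom G Q q
    using q by unfold_locales (simp add: ord_hom_def)
  have sc: "s b \<in> carrier G" if "b \<in> carrier Q" for b
    using s that by (auto simp: ord_hom_def hom_def)
  have qk: "q (k x) = \<one>\<^bsub>Q\<^esub>" if "x \<in> carrier K" for x
    using that k by (auto simp: kernel_def)
  have fac: "\<exists>!u. u \<in> ord_hom Q Z \<inter> extensional (carrier Q) \<and> (\<forall>g\<in>carrier G. u (q g) = h g)"
    if Z: "ordered_group Z" and h: "h \<in> ord_hom G Z"
      and hk: "\<forall>x\<in>carrier K. h (k x) = \<one>\<^bsub>Z\<^esub>" for Z :: "('g + 'q) ordgrp" and h
  proof (rule ex1I[of _ "restrict (h \<circ> s) (carrier Q)"])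
    interpret Z: ordered_group Z by fact
    interpret h: group_hom G Z h
      using h by unfold_locales (simp add: ord_hom_def)
    have "h (s (q g)) = h g" if g: "g \<in> carrier G" for g
    proof -
      \<comment> \<open>The elements \<open>g\<close> and \<open>s (q g)\<close> have the same image
        under \<open>q\<close>, so their quotient lies in the kernel and \<open>h\<close> sends it
        to one.\<close>
      have "g \<otimes>\<^bsub>G\<^esub> inv\<^bsub>G\<^esub> (s (q g)) \<in> k ` carrier K"
        using g sc qs by (simp add: k kernel_def)
      then have "h (g \<otimes>\<^bsub>G\<^esub> inv\<^bsub>G\<^esub> (s (q g))) = \<one>\<^bsub>Z\<^esub>" using hk by auto
      then have "h g \<otimes>\<^bsub>Z\<^esub> inv\<^bsub>Z\<^esub> (h (s (q g))) = \<one>\<^bsub>Z\<^esub>" using g sc by simp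
      then show ?thesis
        using g sc by (metis Z.inv_closed Z.inv_equality Z.inv_inv h.hom_closed q.hom_closed)
    qed
    then show "restrict (h \<circ> s) (carrier Q) \<in> ord_hom Q Z \<inter> extensional (carrier Q) \<and>
        (\<forall>g\<in>carrier G. restrict (h \<circ> s) (carrier Q) (q g) = h g)"
      using ord_hom_compose[OF Q.is_group s h] by simp
    fix u assume u: "u \<in> ord_hom Q Z \<inter> extensional (carrier Q) \<and> (\<forall>g\<in>carrier G. u (q g) = h g)"
    show "u = restrict (h \<circ> s) (carrier Q)"
    proof (rule extensionalityI)
      fix b assume "b \<in> carrier Q"
      moreover from this have "u (q (s b)) = h (s b)" using u sc by blast
      ultimately show "u b = restrict (h \<circ> s) (carrier Q) b" by (simp add: qs)
    qed (use u in auto)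
  qed
  show ?thesis
    unfolding ord_cokernel_def using q qk fac by (intro conjI allI impI ballI)
qed


section \<open>Semidirect products\<close>

locale ordered_group_action = X: ordered_group X + B: ordered_group B
  for X :: "'x ordgrp" and B :: "'b ordgrp" +
  fixes \<phi> :: "'b \<Rightarrow> 'x \<Rightarrow> 'x"
  assumes acts: "acts_by_automorphisms B X \<phi>"
begin

sublocale \<phi>: group_action B "carrier X" \<phi>
  using acts by (simp add: acts_by_automorphisms_def)

abbreviation S :: "('x \<times> 'b) monoid" where "S \<equiv> semidirect X B \<phi>"

lemma action_group_hom:
  assumes "b \<in> carrier B"
  shows "group_hom X X (\<phi> b)"
  using acts assms by unfold_locales (simp add: acts_by_automorphisms_def auto_def)

lemma action_closed [simp]:
  assumes "b \<in> carrier B" "x \<in> carrier X"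
  shows "\<phi> b x \<in> carrier X"
  using assms by (rule \<phi>.element_image) simp

lemma action_mult [simp]:
  assumes "b \<in> carrier B" "x \<in> carrier X" "y \<in> carrier X"
  shows "\<phi> b (x \<otimes>\<^bsub>X\<^esub> y) = \<phi> b x \<otimes>\<^bsub>X\<^esub> \<phi> b y"
  using group_hom.hom_mult[OF action_group_hom] assms by blast

lemma action_one [simp]:
  assumes "b \<in> carrier B"
  shows "\<phi> b \<one>\<^bsub>X\<^esub> = \<one>\<^bsub>X\<^esub>"
  using group_hom.hom_one[OF action_group_hom] assms by blast

lemma action_inv [simp]:
  assumes "b \<in> carrier B" "x \<in> carrier X"
  shows "\<phi> b (inv\<^bsub>X\<^esub> x) = inv\<^bsub>X\<^esub> (\<phi> b x)"
  using group_hom.hom_inv[OF action_group_hom] assms by blast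

lemma action_by_one [simp]:
  assumes "x \<in> carrier X"
  shows "\<phi> \<one>\<^bsub>B\<^esub> x = x"
  using \<phi>.id_eq_one assms by (metis restrict_apply')

lemma action_by_mult [simp]:
  assumes "b \<in> carrier B" "c \<in> carrier B" "x \<in> carrier X"
  shows "\<phi> (b \<otimes>\<^bsub>B\<^esub> c) x = \<phi> b (\<phi> c x)"
  using \<phi>.composition_rule assms by simp

section \<open>Arithmetic of the semidirect product\<close>

lemma semidirect_simps [simp]:
  "carrier S = carrier X \<times> carrier B"
  "(x, b) \<otimes>\<^bsub>S\<^esub> (x', b') = (x \<otimes>\<^bsub>X\<^esub> \<phi> b x', b \<otimes>\<^bsub>B\<^esub> b')"
  "\<one>\<^bsub>S\<^esub> = (\<one>\<^bsub>X\<^esub>, \<one>\<^bsub>B\<^esub>)"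
  by (simp_all add: semidirect_def)

sublocale S: group S
proof (rule groupI)
  fix g assume "g \<in> carrier S"
  then obtain x b where g: "g = (x, b)" "x \<in> carrier X" "b \<in> carrier B" by auto
  have "(\<phi> (inv\<^bsub>B\<^esub> b) (inv\<^bsub>X\<^esub> x), inv\<^bsub>B\<^esub> b) \<otimes>\<^bsub>S\<^esub> g = \<one>\<^bsub>S\<^esub>"
    using g by simp
  moreover have "(\<phi> (inv\<^bsub>B\<^esub> b) (inv\<^bsub>X\<^esub> x), inv\<^bsub>B\<^esub> b) \<in> carrier S"
    using g by simp
  ultimately show "\<exists>h\<in>carrier S. h \<otimes>\<^bsub>S\<^esub> g = \<one>\<^bsub>S\<^esub>" by blast
qed (auto simp: X.m_assoc B.m_assoc)

lemma semidirect_div: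
  assumes "x \<in> carrier X" "y \<in> carrier X" "b \<in> carrier B" "c \<in> carrier B"
  shows "(y, c) \<otimes>\<^bsub>S\<^esub> inv\<^bsub>S\<^esub> (x, b) =
    (y \<otimes>\<^bsub>X\<^esub> inv\<^bsub>X\<^esub> (\<phi> (c \<otimes>\<^bsub>B\<^esub> inv\<^bsub>B\<^esub> b) x), c \<otimes>\<^bsub>B\<^esub> inv\<^bsub>B\<^esub> b)"
proof -
  have "(y \<otimes>\<^bsub>X\<^esub> inv\<^bsub>X\<^esub> (\<phi> (c \<otimes>\<^bsub>B\<^esub> inv\<^bsub>B\<^esub> b) x), c \<otimes>\<^bsub>B\<^esub> inv\<^bsub>B\<^esub> b) \<otimes>\<^bsub>S\<^esub> (x, b) = (y, c)"
    using assms by (simp add: X.m_assoc B.m_assoc del: action_by_mult)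
  then show ?thesis
    using assms by (intro S.inv_solve_right'[THEN iffD2]) auto
qed

text \<open>The element acting on \<open>y\<close> is kept whole as a conjugate of \<open>b\<close>,
  without expansion by \<open>action_by_mult\<close>, so that a hypothesis on elements equivalent to
  one can be applied to it.\<close>

lemma semidirect_conj:
  assumes "x \<in> carrier X" "y \<in> carrier X" "b \<in> carrier B" "c \<in> carrier B"
  shows "(y, c) \<otimes>\<^bsub>S\<^esub> (x, b) \<otimes>\<^bsub>S\<^esub> inv\<^bsub>S\<^esub> (y, c) =
    (y \<otimes>\<^bsub>X\<^esub> \<phi> c x \<otimes>\<^bsub>X\<^esub> inv\<^bsub>X\<^esub> (\<phi> (c \<otimes>\<^bsub>B\<^esub> b \<otimes>\<^bsub>B\<^esub> inv\<^bsub>B\<^esub> c) y), c \<otimes>\<^bsub>B\<^esub> b \<otimes>\<^bsub>B\<^esub> inv\<^bsub>B\<^esub> c)"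
  using assms by (simp add: semidirect_div del: action_by_mult)

text \<open>Both alternatives in \<open>lex_cone\<close> force \<open>b\<close> to be positive, and
  \<open>b \<preceq> \<one>\<close> tells them apart. The condition on \<open>x\<close> thus becomes
  an implication.\<close>

lemma mem_lex_cone:
  "(x, b) \<in> lex_cone X B \<longleftrightarrow> x \<in> carrier X \<and> b \<in> carrier B \<and> \<one>\<^bsub>B\<^esub> \<preceq>\<^bsub>B\<^esub> b \<and>
    (b \<preceq>\<^bsub>B\<^esub> \<one>\<^bsub>B\<^esub> \<longrightarrow> \<one>\<^bsub>X\<^esub> \<preceq>\<^bsub>X\<^esub> x)"
  by (auto simp: lex_cone_def strictly_positive_def ord_equiv_def)

section \<open>Consequences of a compatible cone for the action\<close>

lemma compatible_cone_kernel:
  assumes "compatible_cone X B \<phi> P" "x \<in> carrier X"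
  shows "(x, \<one>\<^bsub>B\<^esub>) \<in> P \<longleftrightarrow> \<one>\<^bsub>X\<^esub> \<preceq>\<^bsub>X\<^esub> x"
proof -
  \<comment> \<open>A kernel carries the induced order, so the fibre of \<open>P\<close> over one is
    the positive cone of \<open>X\<close> itself.\<close>
  have "\<one>\<^bsub>X\<^esub> \<preceq>\<^bsub>X\<^esub> x \<longleftrightarrow> (\<one>\<^bsub>X\<^esub>, \<one>\<^bsub>B\<^esub>) \<preceq>\<^bsub>with_cone S P\<^esub> (x, \<one>\<^bsub>B\<^esub>)"
    using assms unfolding compatible_cone_def ord_split_extension_def ord_kernel_def by blast
  then show ?thesis using assms(2) by (simp add: semidirect_div)
qed

lemma compatible_cone_section:
  assumes "compatible_cone X B \<phi> P" "b \<in> carrier B" "\<one>\<^bsub>B\<^esub> \<preceq>\<^bsub>B\<^esub> b"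
  shows "(\<one>\<^bsub>X\<^esub>, b) \<in> P"
proof -
  have "(\<one>\<^bsub>X\<^esub>, \<one>\<^bsub>B\<^esub>) \<preceq>\<^bsub>with_cone S P\<^esub> (\<one>\<^bsub>X\<^esub>, b)"
    using assms unfolding compatible_cone_def ord_split_extension_def ord_hom_def monotone_on_def
    by blast
  then show ?thesis using assms(2) by (simp add: semidirect_div)
qed

text \<open>Two special cases matter: \<open>y = \<one>\<close> applies the action to the fibre
  component, and \<open>c = \<one>\<close> with \<open>x = \<one>\<close> produces
  \<open>y \<otimes> inv (\<phi> b y)\<close>.\<close>

lemma compatible_cone_conj:
  assumes "compatible_cone X B \<phi> P" "(x, b) \<in> P"
    and "x \<in> carrier X" "y \<in> carrier X" "b \<in> carrier B" "c \<in> carrier B"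
  shows "(y \<otimes>\<^bsub>X\<^esub> \<phi> c x \<otimes>\<^bsub>X\<^esub> inv\<^bsub>X\<^esub> (\<phi> (c \<otimes>\<^bsub>B\<^esub> b \<otimes>\<^bsub>B\<^esub> inv\<^bsub>B\<^esub> c) y),
    c \<otimes>\<^bsub>B\<^esub> b \<otimes>\<^bsub>B\<^esub> inv\<^bsub>B\<^esub> c) \<in> P"
proof -
  have "(y, c) \<in> carrier S" using assms by simp
  then have "(y, c) \<otimes>\<^bsub>S\<^esub> (x, b) \<otimes>\<^bsub>S\<^esub> inv\<^bsub>S\<^esub> (y, c) \<in> P"
    using assms(1,2) unfolding compatible_cone_def positive_cone_def by blast
  then show ?thesis by (simp only: semidirect_conj assms)
qed

lemma compatible_cone_imp_action_mono:
  assumes P: "compatible_cone X B \<phi> P" and b: "b \<in> carrier B"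
  shows "monotone_on (carrier X) (leq X) (leq X) (\<phi> b)"
proof (rule monotone_onI)
  fix x y assume c: "x \<in> carrier X" "y \<in> carrier X" and "x \<preceq>\<^bsub>X\<^esub> y"
  let ?z = "y \<otimes>\<^bsub>X\<^esub> inv\<^bsub>X\<^esub> x"
  have "(?z, \<one>\<^bsub>B\<^esub>) \<in> P"
    using c \<open>x \<preceq>\<^bsub>X\<^esub> y\<close> by (simp add: compatible_cone_kernel[OF P] X.leq_iff_one_leq_div[of x])
  then have "(\<phi> b ?z, \<one>\<^bsub>B\<^esub>) \<in> P"
    using compatible_cone_conj[OF P, of ?z "\<one>\<^bsub>B\<^esub>" "\<one>\<^bsub>X\<^esub>" b] b c by simp
  then show "\<phi> b x \<preceq>\<^bsub>X\<^esub> \<phi> b y"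
    using b c by (simp add: compatible_cone_kernel[OF P] X.leq_iff_one_leq_div[of "\<phi> b x"])
qed

lemma compatible_cone_imp_action_equiv:
  assumes P: "compatible_cone X B \<phi> P" and b: "b \<in> carrier B" and eq: "ord_equiv B b \<one>\<^bsub>B\<^esub>"
    and x: "x \<in> carrier X"
  shows "ord_equiv X (\<phi> b x) x"
proof -
  have P1: "(\<one>\<^bsub>X\<^esub>, b) \<in> P" "(\<one>\<^bsub>X\<^esub>, inv\<^bsub>B\<^esub> b) \<in> P"
    using eq b compatible_cone_section[OF P] B.leq_one_iff_one_leq_inv
    by (auto simp: ord_equiv_def)
  have le: "\<phi> b y \<preceq>\<^bsub>X\<^esub> y" if y: "y \<in> carrier X" for y
  proof -
    have "(y \<otimes>\<^bsub>X\<^esub> inv\<^bsub>X\<^esub> (\<phi> b y), b) \<in> P"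
      using compatible_cone_conj[OF P P1(1), of y "\<one>\<^bsub>B\<^esub>"] b y by simp
    \<comment> \<open>Since \<open>\<phi> b\<close> fixes \<open>\<one>\<close>, this factor leaves
      the \<open>X\<close> component alone and moves the element into the fibre over one, where
      \<open>P\<close> is the cone of \<open>X\<close>.\<close>
    then have "(y \<otimes>\<^bsub>X\<^esub> inv\<^bsub>X\<^esub> (\<phi> b y), b) \<otimes>\<^bsub>S\<^esub> (\<one>\<^bsub>X\<^esub>, inv\<^bsub>B\<^esub> b) \<in> P"
      using P P1 by (intro submonoid.m_closed) (auto simp: compatible_cone_def positive_cone_def)
    then show ?thesis
      using b y by (simp add: compatible_cone_kernel[OF P] X.leq_iff_one_leq_div[of "\<phi> b y"])
  qed
  \<comment> \<open>The bound at \<open>inv x\<close> reads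
    \<open>inv (\<phi> b x) \<preceq> inv x\<close>. Multiplying by \<open>\<phi> b x\<close> on the
    left and by \<open>x\<close> on the right turns it into the reverse bound at
    \<open>x\<close>.\<close>
  have "\<phi> b x \<otimes>\<^bsub>X\<^esub> inv\<^bsub>X\<^esub> (\<phi> b x) \<otimes>\<^bsub>X\<^esub> x \<preceq>\<^bsub>X\<^esub> \<phi> b x \<otimes>\<^bsub>X\<^esub> inv\<^bsub>X\<^esub> x \<otimes>\<^bsub>X\<^esub> x"
    using le[of "inv\<^bsub>X\<^esub> x"] b x by (intro X.mult_mono X.leq_refl) auto
  then have "x \<preceq>\<^bsub>X\<^esub> \<phi> b x"
    using b x by (simp add: X.m_assoc)
  with le[OF x] show ?thesis by (simp add: ord_equiv_def)
qed

section \<open>The lexicographic cone\<close>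

lemma positive_cone_lex_cone:
  assumes mono: "\<And>b. b \<in> carrier B \<Longrightarrow> monotone_on (carrier X) (leq X) (leq X) (\<phi> b)"
    and equiv: "\<And>b x. b \<in> carrier B \<Longrightarrow> ord_equiv B b \<one>\<^bsub>B\<^esub> \<Longrightarrow> x \<in> carrier X \<Longrightarrow>
      ord_equiv X (\<phi> b x) x"
  shows "positive_cone S (lex_cone X B)"
proof -
  have pos: "\<one>\<^bsub>X\<^esub> \<preceq>\<^bsub>X\<^esub> \<phi> b x" if "b \<in> carrier B" "x \<in> carrier X" "\<one>\<^bsub>X\<^esub> \<preceq>\<^bsub>X\<^esub> x" for b x
    using monotone_onD[OF mono[OF that(1)] X.one_closed that(2,3)] that by simp
  have "submonoid (lex_cone X B) S"
  proof
    \<comment> \<open>If the base component of the product is below one,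
      \<open>mult_leq_one_imp\<close> puts both base components below one. Then both fibre
      components are positive, and \<open>pos\<close> takes care of the one twisted by the
      action.\<close>
    fix g h assume "g \<in> lex_cone X B" "h \<in> lex_cone X B"
    then show "g \<otimes>\<^bsub>S\<^esub> h \<in> lex_cone X B"
      by (cases g; cases h)
        (auto simp: mem_lex_cone intro!: B.one_leq_mult X.one_leq_mult pos
          dest: B.mult_leq_one_imp)
  qed (auto simp: mem_lex_cone X.leq_refl B.leq_refl)
  moreover have "g \<otimes>\<^bsub>S\<^esub> p \<otimes>\<^bsub>S\<^esub> inv\<^bsub>S\<^esub> g \<in> lex_cone X B"
    if "g \<in> carrier S" "p \<in> lex_cone X B" for g p
  proof -
    obtain y c x b where gp: "g = (y, c)" "p = (x, b)" by (cases g; cases p)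
    with that have c: "y \<in> carrier X" "c \<in> carrier B" "x \<in> carrier X" "b \<in> carrier B"
      and b: "\<one>\<^bsub>B\<^esub> \<preceq>\<^bsub>B\<^esub> b" and x: "b \<preceq>\<^bsub>B\<^esub> \<one>\<^bsub>B\<^esub> \<Longrightarrow> \<one>\<^bsub>X\<^esub> \<preceq>\<^bsub>X\<^esub> x"
      by (auto simp: mem_lex_cone)
    let ?d = "c \<otimes>\<^bsub>B\<^esub> b \<otimes>\<^bsub>B\<^esub> inv\<^bsub>B\<^esub> c"
    have d: "?d \<in> carrier B" "\<one>\<^bsub>B\<^esub> \<preceq>\<^bsub>B\<^esub> ?d"
      using b c by (auto intro: B.one_leq_conj)
    \<comment> \<open>If \<open>?d\<close> is below one, so is \<open>b\<close>, hence
      \<open>x\<close> is positive. The fibre component then splits into the conjugate of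
      \<open>\<phi> c x\<close> by \<open>y\<close>, positive by monotonicity, and
      \<open>y \<otimes> inv (\<phi> ?d y)\<close>, positive because \<open>?d\<close> is equivalent
      to one.\<close>
    have "\<one>\<^bsub>X\<^esub> \<preceq>\<^bsub>X\<^esub> y \<otimes>\<^bsub>X\<^esub> \<phi> c x \<otimes>\<^bsub>X\<^esub> inv\<^bsub>X\<^esub> (\<phi> ?d y)" if le: "?d \<preceq>\<^bsub>B\<^esub> \<one>\<^bsub>B\<^esub>"
    proof -
      have "\<one>\<^bsub>X\<^esub> \<preceq>\<^bsub>X\<^esub> y \<otimes>\<^bsub>X\<^esub> \<phi> c x \<otimes>\<^bsub>X\<^esub> inv\<^bsub>X\<^esub> y"
        using le c x by (intro X.one_leq_conj pos) (auto simp: B.conj_leq_one_iff)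
      moreover have "\<one>\<^bsub>X\<^esub> \<preceq>\<^bsub>X\<^esub> y \<otimes>\<^bsub>X\<^esub> inv\<^bsub>X\<^esub> (\<phi> ?d y)"
        using equiv[OF d(1) _ c(1)] le d c
        by (simp add: ord_equiv_def X.leq_iff_one_leq_div[of "\<phi> ?d y"] del: action_by_mult)
      ultimately have "\<one>\<^bsub>X\<^esub> \<preceq>\<^bsub>X\<^esub> (y \<otimes>\<^bsub>X\<^esub> \<phi> c x \<otimes>\<^bsub>X\<^esub> inv\<^bsub>X\<^esub> y) \<otimes>\<^bsub>X\<^esub> (y \<otimes>\<^bsub>X\<^esub> inv\<^bsub>X\<^esub> (\<phi> ?d y))"
        by (rule X.one_leq_mult[rotated 2]) (use c d(1) in \<open>auto simp del: action_by_mult\<close>)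
      then show ?thesis
        using c d(1) by (simp add: X.m_assoc del: action_by_mult)
    qed
    then show ?thesis
      unfolding gp semidirect_conj[OF c(3,1,4,2)] mem_lex_cone
      using c d by (auto simp del: action_by_mult)
  qed
  ultimately show ?thesis by (simp add: positive_cone_def)
qed

text \<open>Given the cone property, the rest is formal. The fibre over one is the cone of
  \<open>X\<close> because \<open>\<one> \<preceq> \<one>\<close> in \<open>B\<close>. Members have
  positive base component, so the projection is monotone. The pair \<open>(\<one>, b)\<close> is a
  member for every positive \<open>b\<close>, so the section is monotone and yields the cokernel
  property.\<close>

lemma compatible_cone_lex_cone:
  assumes P: "positive_cone S (lex_cone X B)"
  shows "compatible_cone X B \<phi> (lex_cone X B)"
proof -
  let ?W = "with_cone S (lex_cone X B)"
  have W: "ordered_group ?W" by (rule ordered_group_with_cone[OF S.is_group P])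
  have emb: "x \<preceq>\<^bsub>X\<^esub> y \<longleftrightarrow> (x, \<one>\<^bsub>B\<^esub>) \<preceq>\<^bsub>?W\<^esub> (y, \<one>\<^bsub>B\<^esub>)" if "x \<in> carrier X" "y \<in> carrier X" for x y
    using that by (simp add: semidirect_div mem_lex_cone B.leq_refl X.leq_iff_one_leq_div[of x])
  have k: "(\<lambda>x. (x, \<one>\<^bsub>B\<^esub>)) \<in> ord_hom X ?W"
    using emb by (auto simp: ord_hom_def hom_def monotone_on_def)
  have q: "(\<lambda>(x, b). b) \<in> ord_hom ?W B"
    by (auto simp: ord_hom_def hom_def monotone_on_def semidirect_div mem_lex_cone
        intro: B.leq_iff_one_leq_div[THEN iffD2])
  have s: "(\<lambda>b. (\<one>\<^bsub>X\<^esub>, b)) \<in> ord_hom B ?W"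
    by (auto simp: ord_hom_def hom_def monotone_on_def semidirect_div mem_lex_cone X.leq_refl
        simp del: action_by_mult dest: B.leq_iff_one_leq_div[THEN iffD1, rotated 2])
  have ker: "(\<lambda>x. (x, \<one>\<^bsub>B\<^esub>)) ` carrier X = kernel ?W B (\<lambda>(x, b). b)"
    by (auto simp: kernel_def)
  have "ord_kernel X ?W B (\<lambda>x. (x, \<one>\<^bsub>B\<^esub>)) (\<lambda>(x, b). b)"
    using k ker emb by (simp add: ord_kernel_def inj_on_def)
  moreover have "ord_cokernel X ?W B (\<lambda>x. (x, \<one>\<^bsub>B\<^esub>)) (\<lambda>(x, b). b)"
    by (rule ord_cokernel_of_section[OF W B.ordered_group_axioms q s _ ker]) simp
  ultimately show ?thesis
    using P W k q s X.ordered_group_axioms B.ordered_group_axioms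
    by (simp add: compatible_cone_def ord_split_extension_def)
qed

end

theorem theorem3p2:
  fixes X :: "'x ordgrp" and B :: "'b ordgrp" and \<phi> :: "'b \<Rightarrow> 'x \<Rightarrow> 'x"
  assumes "ordered_group X" and "ordered_group B" and "acts_by_automorphisms B X \<phi>"
  shows "((\<exists>P. compatible_cone X B \<phi> P) \<longleftrightarrow>
      (\<forall>b\<in>carrier B.
        monotone_on (carrier X) (leq X) (leq X) (\<phi> b) \<and>
        (ord_equiv B b \<one>\<^bsub>B\<^esub> \<longrightarrow> (\<forall>x\<in>carrier X. ord_equiv X (\<phi> b x) x)))) \<and>
    ((\<exists>P. compatible_cone X B \<phi> P) \<longleftrightarrow>
      positive_cone (semidirect X B \<phi>) (lex_cone X B) \<and>
      compatible_cone X B \<phi> (lex_cone X B))"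
proof -
  interpret ordered_group_action X B \<phi>
    using assms by (simp add: ordered_group_action_def ordered_group_action_axioms_def)
  show ?thesis
    \<comment> \<open>Any compatible cone forces both conditions on the action; these make
      \<open>lex_cone X B\<close> a compatible cone, which in turn is a witness for
      existence.\<close>
    using compatible_cone_imp_action_mono compatible_cone_imp_action_equiv
      positive_cone_lex_cone compatible_cone_lex_cone
    by meson
qed

end
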